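(* For every integer $m\ge 1$, $$ \pi^{4m-1} = \frac{4^{2m-1}}{D_m}\, S_{4m-1}(1) - \frac{4^{2m-1}+1}{D_m}\, S_{4m-1}(2) + \frac{1}{D_m}\, S_{4m-1}(4). $$
   Context: For a positive integer $n$ and real $r>0$, $S_n(r)=\sum_{k=1}^{\infty}\frac{1}{k^n(e^{\pi r k}-1)}$. The Bernoulli numbers $B_k$ are defined by $\frac{x}{e^x-1}=\sum_{n=0}^\infty \frac{B_n x^n}{n!}$ for $|x|<2\pi$. For a nonnegative integer $n$, $$F_n=\sum_{k=0}^{n+1}(-1)^k\frac{B_{2k}B_{2n+2-2k}}{(2k)!(2n+2-2k)!},\qquad G_n=\sum_{k=0}^{n+1}(-4)^k\frac{B_{2k}B_{2n+2-2k}}{(2k)!(2n+2-2k)!}.$$ For an integer $m\ge 1$, $$D_m=\frac{4^{2m-1}\big[(4^{2m-1}+1)F_{2m-1}-G_{2m-1}\big]}{2}.$$ *)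

theory Defs
  imports "HOL-Complex_Analysis.Complex_Analysis"
begin

text \<open>
  The Bernoulli numbers are read off the exponential generating function \<open>X / (exp X - 1)\<close>, so that
  \<open>B\<^sub>1 = -1/2\<close>. The definition divides formal power series; \<open>bernoulli_sums\<close> and
  \<open>bernoulli_unique\<close> below show that these are the numbers given by the expansion of
  \<open>x / (exp x - 1)\<close> on the punctured disc \<open>0 < |x| < 2\<pi>\<close>.
\<close>

definition bernoulli :: "nat \<Rightarrow> real" where
  "bernoulli n = fact n * fps_nth (fps_X / (fps_exp 1 - 1)) n"

lemma fps_exp_minus_1_nz: "fps_exp 1 - 1 \<noteq> (0 :: 'a :: {field_char_0} fps)"
proof
  assume "fps_exp 1 - 1 = (0 :: 'a fps)"
  hence "fps_nth (fps_exp 1 - 1 :: 'a fps) 1 = 0" by simp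
  thus False by simp
qed

lemma subdegree_fps_exp_minus_1: "subdegree (fps_exp 1 - 1 :: 'a :: field_char_0 fps) = 1"
  by (rule subdegreeI) auto

lemma fps_X_div_exp_mult:
  "fps_X / (fps_exp 1 - 1) * (fps_exp 1 - 1) = (fps_X :: 'a :: field_char_0 fps)"
proof -
  have "fps_exp 1 - 1 dvd (fps_X :: 'a fps)"
    by (subst fps_dvd_iff) (simp_all only: fps_exp_minus_1_nz subdegree_fps_exp_minus_1 fps_X_neq_zero
        subdegree_fps_X not_False_eq_True order_refl)
  thus ?thesis by simp
qed

lemma fps_nth_bernoulli_complex:
  "fps_nth (fps_X / (fps_exp 1 - 1)) n = (of_real (bernoulli n / fact n) :: complex)"
proof -
  define F where "F = (fps_X / (fps_exp 1 - 1) :: real fps)"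
  define G where "G = Abs_fps (\<lambda>n. of_real (fps_nth F n) :: complex)"
  have "G * (fps_exp 1 - 1) = fps_X"
  proof (rule fps_ext)
    fix n
    have "of_real (fps_nth (F * (fps_exp 1 - 1)) n) = (of_real (fps_nth fps_X n) :: complex)"
      unfolding F_def fps_X_div_exp_mult ..
    thus "fps_nth (G * (fps_exp 1 - 1)) n = fps_nth fps_X n"
      by (simp add: fps_mult_nth G_def if_distrib[of of_real] cong: if_cong split: if_splits)
  qed
  hence "G = fps_X / (fps_exp 1 - 1)"
    using fps_X_div_exp_mult[where 'a = complex] fps_exp_minus_1_nz[where 'a = complex]
    by (metis mult_right_cancel)
  thus ?thesis
    by (metis G_def F_def bernoulli_def fps_nth_Abs_fps fact_nonzero nonzero_mult_div_cancel_left)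
qed

theorem bernoulli_sums:
  fixes x :: complex
  assumes "x \<noteq> 0" "norm x < 2 * pi"
  shows "(\<lambda>n. of_real (bernoulli n) * x ^ n / fact n) sums (x / (exp x - 1))"
proof -
  let ?f = "fps_X :: complex fps" and ?g = "fps_exp 1 - 1 :: complex fps"
  have rad: "fps_conv_radius ?g = \<infinity>"
    using fps_conv_radius_diff[of "fps_exp 1 :: complex fps" 1] by simp
  have ev: "eval_fps ?g z = exp z - 1" for z
    by (subst eval_fps_diff) auto
  have nz: "eval_fps ?g z \<noteq> 0" if z: "z \<in> eball 0 (ereal (2 * pi))" "z \<noteq> 0" for z
  proof
    assume "eval_fps ?g z = 0"
    hence "exp z = 1" by (simp add: ev)
    then obtain k :: int where k: "Re z = 0" "Im z = of_int (2 * k) * pi"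
      by (auto simp: exp_eq_1)
    with z have "k \<noteq> 0" by (auto simp: complex_eq_iff)
    hence "1 \<le> \<bar>real_of_int k\<bar>" by linarith
    hence "2 * pi \<le> \<bar>Im z\<bar>" by (simp add: k abs_mult)
    also have "\<dots> \<le> norm z" by (rule abs_Im_le_cmod)
    finally show False using z by simp
  qed
  have sub: "subdegree ?g \<le> subdegree ?f"
    by (simp only: subdegree_fps_exp_minus_1 subdegree_fps_X order_refl)
  have pos: "0 < fps_conv_radius ?f" "0 < fps_conv_radius ?g" "0 < ereal (2 * pi)"
    by (simp_all add: rad)
  have "ereal (norm x) < fps_conv_radius (?f / ?g)"
  proof (rule less_le_trans)
    show "ereal (norm x) < ereal (2 * pi)" using assms(2) by simp
    show "ereal (2 * pi) \<le> fps_conv_radius (?f / ?g)"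
      using fps_conv_radius_divide[OF sub pos nz] by (simp add: rad)
  qed
  hence "(\<lambda>n. fps_nth (?f / ?g) n * x ^ n) sums eval_fps (?f / ?g) x"
    by (rule sums_eval_fps)
  also have "eval_fps (?f / ?g) x = x / (exp x - 1)"
  proof -
    have "eval_fps (?f / ?g) x = (if x = 0 then fps_nth ?f (subdegree ?g) / fps_nth ?g (subdegree ?g)
        else eval_fps ?f x / eval_fps ?g x)"
      by (rule eval_fps_divide[OF sub pos nz]) (use assms(2) rad in simp_all)
    thus ?thesis using assms(1) by (simp only: ev eval_fps_X if_False)
  qed
  finally show ?thesis
    by (simp add: fps_nth_bernoulli_complex)
qed

corollary bernoulli_sums_real:
  fixes x :: real
  assumes "x \<noteq> 0" "\<bar>x\<bar> < 2 * pi"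
  shows "(\<lambda>n. bernoulli n * x ^ n / fact n) sums (x / (exp x - 1))"
proof -
  have "(\<lambda>n. of_real (bernoulli n * x ^ n / fact n) :: complex) sums of_real (x / (exp x - 1))"
    using bernoulli_sums[of "of_real x"] assms by (simp add: exp_of_real)
  thus ?thesis by (simp only: sums_of_real_iff)
qed

theorem bernoulli_unique:
  fixes B :: "nat \<Rightarrow> real"
  assumes "\<And>x. x \<noteq> 0 \<Longrightarrow> \<bar>x\<bar> < 2 * pi \<Longrightarrow> (\<lambda>n. B n * x ^ n / fact n) sums (x / (exp x - 1))"
  shows "B = bernoulli"
proof -
  let ?c = "\<lambda>n. (B n - bernoulli n) / fact n"
  let ?a = "\<lambda>n. case n of 0 \<Rightarrow> 0 | Suc k \<Rightarrow> ?c k"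
  have sums: "(\<lambda>n. ?c n * x ^ n) sums 0" if "x \<noteq> 0" "\<bar>x\<bar> < 2 * pi" for x
  proof -
    have "(\<lambda>n. B n * x ^ n / fact n - bernoulli n * x ^ n / fact n) sums 0"
      using sums_diff[OF assms[OF that] bernoulli_sums_real[OF that]] by simp
    moreover have "B n * x ^ n / fact n - bernoulli n * x ^ n / fact n = ?c n * x ^ n" for n
      by (simp add: field_simps)
    ultimately show ?thesis by simp
  qed
  have zero: "(\<lambda>n. ?a n * (x - 0) ^ n) sums 0" if "norm (x - 0) < 2 * pi" for x :: real
  proof (cases "x = 0")
    case False
    have "(\<lambda>n. x * (?c n * x ^ n)) sums (x * 0)"
      using that False by (intro sums_mult sums) auto
    hence "(\<lambda>n. ?a (Suc n) * x ^ Suc n) sums 0" by (simp add: mult_ac)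
    thus ?thesis by (subst (asm) sums_Suc_iff) simp
  qed simp
  have "?c n = 0" for n
  proof (rule ccontr)
    assume "?c n \<noteq> 0"
    hence nz: "?a (Suc n) \<noteq> 0" by simp
    obtain s where s: "0 < s" "\<And>z. z \<in> cball (0::real) s - {0} \<Longrightarrow> (0::real) \<noteq> 0"
      by (rule powser_0_nonzero[of "2 * pi" 0 ?a "\<lambda>_. 0" "Suc n"]) (use zero nz in auto)
    from s(2)[of s] s(1) show False by simp
  qed
  thus ?thesis by (intro ext) simp
qed

definition S_series :: "nat \<Rightarrow> real \<Rightarrow> real" where
  "S_series n r = (\<Sum>k. 1 / (real (Suc k) ^ n * (exp (pi * r * real (Suc k)) - 1)))"

lemma summable_S_series:
  assumes "n \<ge> 1" "r > 0"
  shows "summable (\<lambda>k. 1 / (real (Suc k) ^ n * (exp (pi * r * real (Suc k)) - 1)))"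
proof (rule summable_comparison_test')
  show "summable (\<lambda>k. inverse (pi * r) * inverse (real (Suc k) ^ 2))"
    by (intro summable_mult, subst summable_Suc_iff) (rule inverse_power_summable, simp)
  fix k :: nat
  let ?k = "real (Suc k)"
  have "pi * r * ?k ^ 2 = ?k ^ 1 * (pi * r * ?k)" by (simp add: power2_eq_square)
  also have "\<dots> \<le> ?k ^ n * (exp (pi * r * ?k) - 1)"
  proof (rule mult_mono)
    show "?k ^ 1 \<le> ?k ^ n" by (rule power_increasing) (use assms in auto)
    show "pi * r * ?k \<le> exp (pi * r * ?k) - 1" using exp_ge_add_one_self[of "pi * r * ?k"] by linarith
  qed (use assms in auto)
  finally have le: "pi * r * ?k ^ 2 \<le> ?k ^ n * (exp (pi * r * ?k) - 1)" .
  have pos: "0 < pi * r * ?k ^ 2" using assms by simp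
  have "norm (1 / (?k ^ n * (exp (pi * r * ?k) - 1))) = inverse (?k ^ n * (exp (pi * r * ?k) - 1))"
    using le pos by (simp only: real_norm_def inverse_eq_divide) (subst abs_of_pos, auto)
  also have "\<dots> \<le> inverse (pi * r * ?k ^ 2)" using le pos by (rule le_imp_inverse_le)
  finally show "norm (1 / (?k ^ n * (exp (pi * r * ?k) - 1))) \<le> inverse (pi * r) * inverse (?k ^ 2)"
    by (simp only: inverse_mult_distrib)
qed

definition F_coeff :: "nat \<Rightarrow> real" where
  "F_coeff n = (\<Sum>k=0..n+1. (-1) ^ k *
     (bernoulli (2*k) * bernoulli (2*n + 2 - 2*k) / (fact (2*k) * fact (2*n + 2 - 2*k))))"

definition G_coeff :: "nat \<Rightarrow> real" where
  "G_coeff n = (\<Sum>k=0..n+1. (-4) ^ k *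
     (bernoulli (2*k) * bernoulli (2*n + 2 - 2*k) / (fact (2*k) * fact (2*n + 2 - 2*k))))"

definition D_coeff :: "nat \<Rightarrow> real" where
  "D_coeff m = 4 ^ (2*m - 1) * ((4 ^ (2*m - 1) + 1) * F_coeff (2*m - 1) - G_coeff (2*m - 1)) / 2"

end

theory Submission
  imports Defs
begin

text \<open>
  By the partial fraction expansion of \<open>coth\<close>, the logarithmic derivative of the product for
  \<open>sinh\<close>, the sum \<open>C(a)\<close> of \<open>coth (\<pi> a k) / k ^ (2N+1)\<close> is, up to \<open>\<zeta>(2N+2)\<close>, a double sum
  of \<open>1 / (k ^ 2N (a\<^sup>2 k\<^sup>2 + j\<^sup>2))\<close> over \<open>k, j \<ge> 1\<close>. For odd \<open>N\<close>, adding the double sum for \<open>1 / a\<close> with \<open>k\<close> and \<open>j\<close>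
  exchanged cancels the denominator \<open>a\<^sup>2 k\<^sup>2 + j\<^sup>2\<close>, because \<open>u + v\<close> divides \<open>u ^ N + v ^ N\<close>. What
  remains is a finite sum of products of even zeta values: Ramanujan's formula relating \<open>C(a)\<close>
  and \<open>C(1 / a)\<close>. The cases \<open>a = 1\<close> and \<open>a = 1/2\<close> involve \<open>S(2)\<close>, and \<open>S(1)\<close> and \<open>S(4)\<close>, and
  eliminating \<open>\<zeta>(2N+1)\<close> between them gives the claim multiplied by \<open>D\<close>. Finally \<open>D \<noteq> 0\<close>, since
  \<open>2 * S(2) \<le> S(1)\<close> makes the combination of the series positive.
\<close>

section \<open>Product for the hyperbolic sine and partial fractions of its logarithmic
  derivative\<close>

text \<open>This is Euler's product for the sine at an imaginary argument. With the linear factor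
  \<open>pi * x\<close> divided out, every factor is positive and the logarithm becomes a
  series.\<close>

lemma sinh_product:
  "(\<lambda>n. \<Prod>k<n. 1 + x\<^sup>2 / (real (Suc k))\<^sup>2) \<longlonglongrightarrow> sinh (pi * x) / (pi * x)" if "x \<noteq> 0"
proof -
  let ?P = "\<lambda>n. pi * x * (\<Prod>k=1..n. 1 + x\<^sup>2 / (real k)\<^sup>2)"
  have "(\<lambda>n. of_real pi * (\<i> * of_real x) * (\<Prod>k=1..n. 1 - (\<i> * of_real x)\<^sup>2 / of_nat k ^ 2))
    \<longlonglongrightarrow> sin (of_real pi * (\<i> * complex_of_real x))"
    by (rule sin_product_formula_complex)
  also have "(\<lambda>n. of_real pi * (\<i> * of_real x) * (\<Prod>k=1..n. 1 - (\<i> * complex_of_real x)\<^sup>2 / of_nat k ^ 2))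
      = (\<lambda>n. \<i> * of_real (?P n))"
    by (simp add: power_mult_distrib mult_ac)
  also have "sin (of_real pi * (\<i> * complex_of_real x)) = \<i> * of_real (sinh (pi * x))"
  proof -
    have "sin (\<i> * complex_of_real (pi * x)) = \<i> * of_real (sinh (pi * x))"
      by (simp add: sin_exp_eq sinh_field_def field_simps flip: exp_of_real)
    thus ?thesis by (simp add: mult_ac)
  qed
  finally have "(\<lambda>n. inverse \<i> * (\<i> * complex_of_real (?P n))) \<longlonglongrightarrow> inverse \<i> * (\<i> * of_real (sinh (pi * x)))"
    by (rule tendsto_mult[OF tendsto_const])
  hence "(\<lambda>n. complex_of_real (?P n)) \<longlonglongrightarrow> of_real (sinh (pi * x))"
    by (simp only: mult.assoc[symmetric] left_inverse[OF complex_i_not_zero] mult_1_left)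
  hence "?P \<longlonglongrightarrow> sinh (pi * x)"
    by (subst (asm) tendsto_of_real_iff)
  hence "(\<lambda>n. ?P n / (pi * x)) \<longlonglongrightarrow> sinh (pi * x) / (pi * x)"
    by (intro tendsto_divide tendsto_const) (use that in auto)
  also have "(\<lambda>n. ?P n / (pi * x)) = (\<lambda>n. \<Prod>k<n. 1 + x\<^sup>2 / (real (Suc k))\<^sup>2)"
    using that by (simp add: prod.atLeast1_atMost_eq)
  finally show ?thesis .
qed

text \<open>The logarithm of \<open>sinh_product\<close> is differentiated term by term. The
  quotient of \<open>cosh\<close> and \<open>sinh\<close> is written with \<open>exp\<close> because
  that is the form occurring in \<open>S_series\<close> and in the Bernoulli generating
  function.\<close>

lemma coth_partial_fractions_pos:
  fixes x :: real
  assumes "x > 0"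
  shows "(\<lambda>k. 2 * x / (x\<^sup>2 + (real (Suc k))\<^sup>2)) sums (pi * (1 + 2 / (exp (2 * pi * x) - 1)) - 1 / x)"
proof -
  let ?f = "\<lambda>k x. ln (1 + x\<^sup>2 / (real (Suc k))\<^sup>2)"
  let ?f' = "\<lambda>k x. 2 * x / (x\<^sup>2 + (real (Suc k))\<^sup>2)"
  have f: "(\<lambda>k. ?f k y) sums ln (sinh (pi * y) / (pi * y))" if "y > 0" for y
  proof -
    have "(\<lambda>n. ln (\<Prod>k<n. 1 + y\<^sup>2 / (real (Suc k))\<^sup>2)) \<longlonglongrightarrow> ln (sinh (pi * y) / (pi * y))"
      using that by (intro tendsto_ln sinh_product) (auto simp: sinh_real_zero_iff)
    moreover have "ln (\<Prod>k<n. 1 + y\<^sup>2 / (real (Suc k))\<^sup>2) = (\<Sum>k<n. ?f k y)" for n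
    proof (rule ln_prod)
      fix k
      have "1 + y\<^sup>2 / (real (Suc k))\<^sup>2 > 0" by (intro add_pos_nonneg) auto
      thus "1 + y\<^sup>2 / (real (Suc k))\<^sup>2 \<noteq> 0" by (rule less_imp_neq[THEN not_sym])
    qed simp
    ultimately show ?thesis by (simp add: sums_def)
  qed
  \<comment> \<open>The bounded interval gives a majorant independent of \<open>y\<close> for the
    Weierstrass test; the upper end only has to exceed \<open>x\<close>.\<close>
  define S where "S = {0<..<x+1}"
  have bound: "norm (?f' k y) \<le> 2 * (x + 1) * inverse (real (Suc k) ^ 2)" if "y \<in> S" for k y
  proof -
    have "norm (?f' k y) = 2 * y * inverse (y\<^sup>2 + (real (Suc k))\<^sup>2)"
      using that by (simp add: S_def divide_inverse)
    also have "\<dots> \<le> 2 * (x + 1) * inverse (real (Suc k) ^ 2)"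
      using that by (intro mult_mono le_imp_inverse_le) (auto simp: S_def)
    finally show ?thesis .
  qed
  have summable: "summable (\<lambda>k. 2 * (x + 1) * inverse (real (Suc k) ^ 2))"
    by (intro summable_mult, subst summable_Suc_iff) (rule inverse_power_summable, simp)
  have unif: "uniformly_convergent_on S (\<lambda>n y. \<Sum>k<n. ?f' k y)"
    by (rule Weierstrass_m_test'[OF bound summable])
  have der: "(?f k has_field_derivative ?f' k y) (at y within S)" if "y \<in> S" for k y
  proof -
    have pos: "1 + y\<^sup>2 / (real (Suc k))\<^sup>2 > 0" by (auto intro: add_pos_nonneg)
    moreover have "((\<lambda>y. 1 + y\<^sup>2 / (real (Suc k))\<^sup>2) has_field_derivative 2 * y / (real (Suc k))\<^sup>2) (at y within S)"
    proof -
      have deriv: "((\<lambda>y. 1 + y\<^sup>2 / c) has_field_derivative 2 * y / c) (at y within S)" if "c > 0" for c :: real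
        using that by (auto intro!: derivative_eq_intros)
      show ?thesis by (rule deriv) simp
    qed
    ultimately have "(?f k has_field_derivative 1 / (1 + y\<^sup>2 / (real (Suc k))\<^sup>2) * (2 * y / (real (Suc k))\<^sup>2)) (at y within S)"
      by (intro DERIV_ln_divide[THEN DERIV_chain2])
    also have "1 / (1 + y\<^sup>2 / (real (Suc k))\<^sup>2) * (2 * y / (real (Suc k))\<^sup>2) = ?f' k y"
      by (simp add: field_simps del: of_nat_Suc)
    finally show ?thesis .
  qed
  have S: "convex S" "x \<in> S" "x \<in> interior S"
    using assms by (simp_all add: S_def interior_open)
  have summable_f: "summable (\<lambda>k. ?f k x)" using f[OF assms] by (simp add: sums_iff)
  have "((\<lambda>y. \<Sum>k. ?f k y) has_field_derivative (\<Sum>k. ?f' k x)) (at x)"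
    by (rule has_field_derivative_series'(2)[OF S(1) der unif S(2) summable_f S(3)])
  moreover have "eventually (\<lambda>y. y \<in> {0<..}) (nhds x)"
    using assms by (intro eventually_nhds_in_open) auto
  hence "eventually (\<lambda>y. (\<Sum>k. ?f k y) = ln (sinh (pi * y) / (pi * y))) (nhds x)"
    by (rule eventually_mono) (use f in \<open>auto simp: sums_iff\<close>)
  ultimately have "((\<lambda>y. ln (sinh (pi * y) / (pi * y))) has_field_derivative (\<Sum>k. ?f' k x)) (at x)"
    by (subst (asm) DERIV_cong_ev[OF refl _ refl])
  moreover have sinh: "sinh (pi * x) > 0" using assms by simp
  have "((\<lambda>y. ln (sinh (pi * y) / (pi * y))) has_field_derivative pi * cosh (pi * x) / sinh (pi * x) - 1 / x) (at x)"
    using assms sinh by (auto intro!: derivative_eq_intros simp: field_simps)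
  ultimately have "(\<Sum>k. ?f' k x) = pi * cosh (pi * x) / sinh (pi * x) - 1 / x"
    by (rule DERIV_unique)
  hence "(\<Sum>k. ?f' k x) = pi * (cosh (pi * x) / sinh (pi * x)) - 1 / x" by simp
  moreover have "cosh (pi * x) / sinh (pi * x) = 1 + 2 / (exp (2 * pi * x) - 1)"
  proof -
    have "exp (2 * pi * x) = exp (pi * x) * exp (pi * x)"
      by (simp add: mult_ac flip: exp_add)
    moreover have "exp (pi * x) > 1" using assms by simp
    moreover from this have "exp (pi * x) * exp (pi * x) > 1" by (simp add: less_1_mult)
    ultimately show ?thesis
      by (simp add: cosh_field_def sinh_field_def exp_minus field_simps)
  qed
  moreover have "summable (\<lambda>k. ?f' k x)"
    by (rule summable_comparison_test'[OF summable]) (use bound S(2) in blast)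
  ultimately show ?thesis by (simp only: sums_iff)
qed

text \<open>Both sides are odd in \<open>x\<close>. Negative arguments matter because
  \<open>bernoulli_unique\<close> asks for the expansion on both sides of 0.\<close>

lemma coth_partial_fractions:
  fixes x :: real
  assumes "x \<noteq> 0"
  shows "(\<lambda>k. 2 * x / (x\<^sup>2 + (real (Suc k))\<^sup>2)) sums (pi * (1 + 2 / (exp (2 * pi * x) - 1)) - 1 / x)"
proof (cases "x > 0")
  case False
  have "(\<lambda>k. - (2 * (-x) / ((-x)\<^sup>2 + (real (Suc k))\<^sup>2))) sums
      (- (pi * (1 + 2 / (exp (2 * pi * (-x)) - 1)) - 1 / (-x)))"
    using False assms by (intro sums_minus coth_partial_fractions_pos) simp
  moreover have "1 + 2 / (exp (- z) - 1) = - (1 + 2 / (exp z - 1))" if "z \<noteq> 0" for z :: real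
    using that by (simp add: exp_minus field_simps)
  from this[of "2 * pi * x"] have "1 + 2 / (exp (2 * pi * (-x)) - 1) = - (1 + 2 / (exp (2 * pi * x) - 1))"
    using assms by simp
  ultimately show ?thesis by (simp only:) (simp add: algebra_simps)
qed (rule coth_partial_fractions_pos)


section \<open>Even zeta values and Bernoulli numbers\<close>

lemma summable_zeta:
  assumes "n \<ge> 2"
  shows "summable (\<lambda>k. 1 / real (Suc k) ^ n)"
proof -
  have "summable (\<lambda>k. inverse (real (Suc k) ^ n))"
    by (subst summable_Suc_iff) (rule inverse_power_summable[OF assms])
  thus ?thesis by (simp only: inverse_eq_divide)
qed

text \<open>
  Euler's closed form of \<open>\<zeta>(2 * k)\<close>. Its value at \<open>k = 0\<close> is \<open>-1/2 = \<zeta>(0)\<close>, which is not the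
  sum of the series there but makes the two end terms of \<open>ramanujan_formula_zeta\<close> fit its sum.
\<close>

definition even_zeta :: "nat \<Rightarrow> real" where
  "even_zeta k = (-1) ^ (k + 1) * bernoulli (2 * k) * (2 * pi) ^ (2 * k) / (2 * fact (2 * k))"

text \<open>Each partial fraction is a geometric series in the negated square of
  \<open>y / real (Suc k)\<close>. Summing the resulting double series over \<open>k\<close> first
  turns the zeta values into coefficients of a power series in \<open>y\<close>.\<close>

lemma zeta_generating_function:
  fixes y :: real
  assumes "y \<noteq> 0" "\<bar>y\<bar> < 1"
  shows "(\<lambda>i. (-1) ^ i * (\<Sum>k. 1 / real (Suc k) ^ (2 * i + 2)) * y ^ (2 * i + 2)) sums
    ((pi * (1 + 2 / (exp (2 * pi * y) - 1)) - 1 / y) * y / 2)"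
proof -
  define h where "h k i = (-1) ^ i * (y / real (Suc k)) ^ (2 * i + 2)" for k i
  let ?Z = "\<lambda>i. \<Sum>k. 1 / real (Suc k) ^ (2 * i + 2)"
  have zsum: "summable (\<lambda>k. 1 / real (Suc k) ^ (2 * i + 2))" for i
    by (rule summable_zeta) simp
  have y2: "y\<^sup>2 < 1" using assms by (simp add: abs_square_less_1)
  \<comment> \<open>Absolute summability justifies the exchange: the majorant is the series of
    \<open>1 / real (Suc k) ^ 2\<close> times a geometric series of ratio
    \<open>y\<^sup>2 < 1\<close>.\<close>
  have "(\<lambda>(k, i). norm (h k i)) summable_on UNIV \<times> UNIV"
  proof (rule summable_on_comparison_test)
    show "(\<lambda>(k, i). 1 / real (Suc k) ^ 2 * (y\<^sup>2) ^ i) summable_on UNIV \<times> UNIV"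
    proof (rule summable_on_SigmaI)
      fix k :: nat
      have "(\<lambda>i. 1 / real (Suc k) ^ 2 * (y\<^sup>2) ^ i) sums (1 / real (Suc k) ^ 2 * (1 / (1 - y\<^sup>2)))"
        by (intro sums_mult geometric_sums) (use y2 in simp)
      thus "((\<lambda>i. (\<lambda>(k, i). 1 / real (Suc k) ^ 2 * (y\<^sup>2) ^ i) (k, i)) has_sum
          (1 / real (Suc k) ^ 2 * (1 / (1 - y\<^sup>2)))) UNIV"
        by (simp only: split) (rule sums_nonneg_imp_has_sum, auto)
    next
      show "(\<lambda>k. 1 / real (Suc k) ^ 2 * (1 / (1 - y\<^sup>2))) summable_on UNIV"
        using summable_zeta[of 2] y2 by (intro summable_nonneg_imp_summable_on summable_mult2) auto
    qed auto
  next
    fix p :: "nat \<times> nat"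
    obtain k i where p: "p = (k, i)" by fastforce
    have "norm (h k i) = 1 / real (Suc k) ^ (2 * i + 2) * (y\<^sup>2) ^ (Suc i)"
      by (simp add: h_def abs_mult power_abs power_divide power_mult power_add power2_eq_square)
    also have "\<dots> \<le> 1 / real (Suc k) ^ 2 * (y\<^sup>2) ^ i"
    proof (rule mult_mono)
      have "real (Suc k) ^ 2 \<le> real (Suc k) ^ (2 * i + 2)" by (rule power_increasing) auto
      thus "1 / real (Suc k) ^ (2 * i + 2) \<le> 1 / real (Suc k) ^ 2"
        by (intro divide_left_mono) auto
      show "(y\<^sup>2) ^ (Suc i) \<le> (y\<^sup>2) ^ i" using y2 by (intro power_decreasing) auto
    qed auto
    finally show "(case p of (k, i) \<Rightarrow> norm (h k i)) \<le> (case p of (k, i) \<Rightarrow> 1 / real (Suc k) ^ 2 * (y\<^sup>2) ^ i)"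
      by (simp add: p)
    show "0 \<le> (case p of (k, i) \<Rightarrow> norm (h k i))" by (simp add: p)
  qed
  hence "(\<lambda>p. norm (case p of (k, i) \<Rightarrow> h k i)) summable_on UNIV \<times> UNIV" by (simp add: case_prod_unfold)
  then obtain A where A: "((\<lambda>(k, i). h k i) has_sum A) (UNIV \<times> UNIV)"
    using abs_summable_summable summable_on_def by blast
  have row: "(h k has_sum (y / 2) * (2 * y / (y\<^sup>2 + (real (Suc k))\<^sup>2))) UNIV" for k
  proof -
    let ?q = "(y / real (Suc k))\<^sup>2"
    have "?q \<le> y\<^sup>2 / 1" unfolding power_divide by (intro divide_left_mono) auto
    hence q: "norm (- ?q) < 1" using y2 by simp
    have "(\<lambda>i. norm (?q * (- ?q) ^ i)) = (\<lambda>i. ?q * ?q ^ i)"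
      by (simp add: abs_mult power_abs power_divide mult_ac)
    moreover have "summable (\<lambda>i. ?q * ?q ^ i)" using q by (intro summable_mult summable_geometric) simp
    moreover have "(\<lambda>i. ?q * (- ?q) ^ i) sums (?q * (1 / (1 - (- ?q))))"
      by (intro sums_mult geometric_sums q)
    ultimately have "((\<lambda>i. ?q * (- ?q) ^ i) has_sum (?q * (1 / (1 - (- ?q))))) UNIV"
      by (intro norm_summable_imp_has_sum) simp_all
    moreover have "?q * (- ?q) ^ i = h k i" for i
      unfolding h_def power_add power_mult power_minus[of ?q i] by (simp only: mult_ac)
    moreover have "?q * (1 / (1 - (- ?q))) = (y / 2) * (2 * y / (y\<^sup>2 + (real (Suc k))\<^sup>2))"
      using assms by (simp add: power_divide field_simps power2_eq_square del: of_nat_Suc)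
    ultimately show ?thesis by simp
  qed
  have "((\<lambda>k. (y / 2) * (2 * y / (y\<^sup>2 + (real (Suc k))\<^sup>2))) has_sum A) UNIV"
    by (rule has_sum_SigmaD[OF A]) (use row in simp)
  hence "(\<lambda>k. (y / 2) * (2 * y / (y\<^sup>2 + (real (Suc k))\<^sup>2))) sums A" by (rule has_sum_imp_sums)
  moreover have "(\<lambda>k. (y / 2) * (2 * y / (y\<^sup>2 + (real (Suc k))\<^sup>2))) sums
      ((y / 2) * (pi * (1 + 2 / (exp (2 * pi * y) - 1)) - 1 / y))"
    by (intro sums_mult coth_partial_fractions assms)
  ultimately have Aeq: "A = (pi * (1 + 2 / (exp (2 * pi * y) - 1)) - 1 / y) * y / 2"
    by (simp add: sums_iff)
  have col: "((\<lambda>k. h k i) has_sum (-1) ^ i * ?Z i * y ^ (2 * i + 2)) UNIV" for i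
  proof -
    have "((\<lambda>k. 1 / real (Suc k) ^ (2 * i + 2)) has_sum ?Z i) UNIV"
      by (intro sums_nonneg_imp_has_sum summable_sums zsum) auto
    hence "((\<lambda>k. (-1) ^ i * y ^ (2 * i + 2) * (1 / real (Suc k) ^ (2 * i + 2))) has_sum
        (-1) ^ i * y ^ (2 * i + 2) * ?Z i) UNIV"
      by (rule has_sum_cmult_right)
    moreover have "(-1) ^ i * y ^ (2 * i + 2) * (1 / real (Suc k) ^ (2 * i + 2)) = h k i" for k
      by (simp add: h_def power_divide)
    ultimately show ?thesis by (simp add: mult_ac)
  qed
  have "((\<lambda>(i, k). h k i) has_sum A) (UNIV \<times> UNIV)"
    using A by (subst has_sum_swap) (simp add: case_prod_unfold)
  hence "((\<lambda>i. (-1) ^ i * ?Z i * y ^ (2 * i + 2)) has_sum A) UNIV"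
    by (rule has_sum_SigmaD) (use col in simp)
  thus ?thesis unfolding Aeq by (rule has_sum_imp_sums)
qed

text \<open>By \<open>bernoulli_unique\<close> it is enough that the claimed values generate
  \<open>x / (exp x - 1)\<close>. The even indices from 2 on come from
  \<open>zeta_generating_function\<close> at \<open>y = x / (2 * pi)\<close>.\<close>

lemma bernoulli_eq_zeta:
  "bernoulli n = (if n = 0 then 1 else if n = 1 then - 1 / 2 else if odd n then 0
     else 2 * (-1) ^ (n div 2 + 1) * (\<Sum>k. 1 / real (Suc k) ^ n) * fact n / (2 * pi) ^ n)"
  (is "_ = ?B n")
proof -
  have "?B = bernoulli"
  proof (rule bernoulli_unique)
    fix x :: real
    assume x: "x \<noteq> 0" "\<bar>x\<bar> < 2 * pi"
    define y where "y = x / (2 * pi)"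
    have y: "y \<noteq> 0" "\<bar>y\<bar> < 1" "2 * pi * y = x" using x by (auto simp: y_def)
    let ?c = "\<lambda>n. ?B n * x ^ n / fact n"
    let ?V = "x / (exp x - 1) + x / 2 - 1"
    have V: "2 * ((pi * (1 + 2 / (exp (2 * pi * y) - 1)) - 1 / y) * y / 2) = ?V"
      unfolding y(3) using x by (simp add: y_def field_simps)
    have "(\<lambda>i. 2 * ((-1) ^ i * (\<Sum>k. 1 / real (Suc k) ^ (2 * i + 2)) * y ^ (2 * i + 2))) sums ?V"
      unfolding V[symmetric] using y by (intro sums_mult zeta_generating_function)
    moreover have "2 * ((-1) ^ i * (\<Sum>k. 1 / real (Suc k) ^ (2 * i + 2)) * y ^ (2 * i + 2)) = ?c (2 * i + 2)" for i
      by (simp add: y_def power_divide)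
    \<comment> \<open>The condition is never true; it only writes each term as the value at
      \<open>n = 2 * i + 2\<close> of one function on all indices, as reindexing requires.\<close>
    ultimately have "(\<lambda>i. (if 2 * i + 2 < 2 then 0 else ?c (2 * i + 2))) sums ?V" by simp
    moreover have "strict_mono (\<lambda>i::nat. 2 * i + 2)" by (auto intro: strict_monoI)
    ultimately have "(\<lambda>n. if n < 2 then 0 else ?c n) sums ?V"
    proof (subst (asm) sums_mono_reindex)
      fix n :: nat assume n: "n \<notin> range (\<lambda>i. 2 * i + 2)"
      have "odd n" if "n \<ge> 2"
      proof
        assume "even n"
        then obtain j where "n = 2 * j" by blast
        with that have "n = 2 * (j - 1) + 2" by simp
        with n show False by blast
      qed
      thus "(if n < 2 then 0 else ?c n) = 0" by auto
    qed
    \<comment> \<open>The indices 0 and 1 contribute \<open>1 - x / 2\<close>, exactly what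
      \<open>?V\<close> lacks.\<close>
    moreover have "(\<lambda>n. if n \<in> {0, 1} then ?c n else 0) sums (\<Sum>n\<in>{0, 1}. ?c n)"
      by (rule sums_If_finite_set) simp
    ultimately have "(\<lambda>n. (if n < 2 then 0 else ?c n) + (if n \<in> {0, 1} then ?c n else 0)) sums
        (?V + (\<Sum>n\<in>{0, 1}. ?c n))"
      by (rule sums_add)
    moreover have "(if n < 2 then 0 else ?c n) + (if n \<in> {0, 1} then ?c n else 0) = ?c n" for n
      by auto
    moreover have "?V + (\<Sum>n\<in>{0, 1}. ?c n) = x / (exp x - 1)" by simp
    ultimately show "?c sums (x / (exp x - 1))" by (simp only:)
  qed
  thus ?thesis by (rule fun_cong[symmetric])
qed

lemma even_zeta_0: "even_zeta 0 = - 1 / 2"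
  by (simp add: even_zeta_def bernoulli_eq_zeta)

lemma even_zeta_has_sum:
  assumes "k > 0"
  shows "((\<lambda>j. 1 / real (Suc j) ^ (2 * k)) has_sum even_zeta k) UNIV"
proof -
  have "summable (\<lambda>j. 1 / real (Suc j) ^ (2 * k))"
    by (rule summable_zeta) (use assms in simp)
  moreover have "even_zeta k = (\<Sum>j. 1 / real (Suc j) ^ (2 * k))"
    using assms by (simp add: even_zeta_def bernoulli_eq_zeta)
  ultimately show ?thesis
    by (intro sums_nonneg_imp_has_sum) (auto simp: sums_iff)
qed


section \<open>Double series over pairs of positive integers\<close>

text \<open>Unconditional sums over pairs, instead of iterated series, can later be added and
  compared term by term with those of \<open>coth_series_double_sum\<close>.\<close>

lemma even_zeta_product_has_sum:
  assumes "s > 0" "t > 0"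
  shows "((\<lambda>(k, j). 1 / (real (Suc k) ^ (2 * s) * real (Suc j) ^ (2 * t))) has_sum
    even_zeta s * even_zeta t) (UNIV \<times> UNIV)"
proof -
  have row: "((\<lambda>j. 1 / (real (Suc k) ^ (2 * s) * real (Suc j) ^ (2 * t))) has_sum
      1 / real (Suc k) ^ (2 * s) * even_zeta t) UNIV" for k
    using has_sum_cmult_right[OF even_zeta_has_sum[OF assms(2)], of "1 / real (Suc k) ^ (2 * s)"] by simp
  have total: "((\<lambda>k. 1 / real (Suc k) ^ (2 * s) * even_zeta t) has_sum even_zeta s * even_zeta t) UNIV"
    by (intro has_sum_cmult_left even_zeta_has_sum assms)
  have "(\<lambda>(k, j). 1 / (real (Suc k) ^ (2 * s) * real (Suc j) ^ (2 * t))) summable_on UNIV \<times> UNIV"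
    by (rule summable_on_SigmaI[where g = "\<lambda>k. 1 / real (Suc k) ^ (2 * s) * even_zeta t"])
      (use row total in \<open>auto simp: summable_on_def simp del: of_nat_Suc\<close>)
  thus ?thesis
    by (rule has_sum_SigmaI[rotated 2]) (use row total in \<open>simp_all del: of_nat_Suc\<close>)
qed

lemma has_sum_sum:
  fixes f :: "'i \<Rightarrow> 'a \<Rightarrow> 'b :: topological_comm_monoid_add"
  assumes "finite I" "\<And>i. i \<in> I \<Longrightarrow> (f i has_sum S i) A"
  shows "((\<lambda>x. \<Sum>i\<in>I. f i x) has_sum (\<Sum>i\<in>I. S i)) A"
  using assms by (induction I rule: finite_induct) (auto intro!: has_sum_add)

text \<open>
  This is the series of \<open>coth (\<pi> * a * k) / k ^ n\<close>, since \<open>coth t = 1 + 2 / (exp (2 * t) - 1)\<close>.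
\<close>

definition coth_series :: "nat \<Rightarrow> real \<Rightarrow> real" where
  "coth_series n a = (\<Sum>k. 1 / real (Suc k) ^ n) + 2 * S_series n (2 * a)"

text \<open>For fixed \<open>k\<close> the sum over \<open>j\<close> is the partial fraction
  expansion at \<open>a * real (Suc k)\<close>, suitably scaled; its term \<open>- 1 / x\<close>
  produces the even zeta value. Nonnegativity of all terms allows the rows to be combined.\<close>

lemma coth_series_double_sum:
  fixes a :: real
  assumes "a > 0" "N > 0"
  shows "((\<lambda>(k, j). 1 / (real (Suc k) ^ (2 * N) * (a\<^sup>2 * (real (Suc k))\<^sup>2 + (real (Suc j))\<^sup>2))) has_sum
    (pi / (2 * a) * coth_series (2 * N + 1) a - even_zeta (N + 1) / (2 * a\<^sup>2))) (UNIV \<times> UNIV)"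
    (is "(?f has_sum ?U) _")
proof -
  define g where "g k = pi / (2 * a) * (1 / real (Suc k) ^ (2 * N + 1) +
      2 * (1 / (real (Suc k) ^ (2 * N + 1) * (exp (pi * (2 * a) * real (Suc k)) - 1)))) -
      1 / (2 * a\<^sup>2) * (1 / real (Suc k) ^ (2 * (N + 1)))" for k
  have row: "((\<lambda>j. ?f (k, j)) has_sum g k) UNIV" for k
  proof -
    define K where "K = real (Suc k)"
    have K: "K > 0" by (simp add: K_def)
    have "(\<lambda>j. 1 / (2 * a * K ^ (2 * N + 1)) * (2 * (a * K) / ((a * K)\<^sup>2 + (real (Suc j))\<^sup>2))) sums
        (1 / (2 * a * K ^ (2 * N + 1)) * (pi * (1 + 2 / (exp (2 * pi * (a * K)) - 1)) - 1 / (a * K)))"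
      using assms K by (intro sums_mult coth_partial_fractions) auto
    moreover have "1 / (2 * a * K ^ (2 * N + 1)) * (2 * (a * K) / ((a * K)\<^sup>2 + (real (Suc j))\<^sup>2)) = ?f (k, j)" for j
      using assms K by (simp add: K_def[symmetric] power_mult_distrib del: of_nat_Suc)
    moreover have "1 / (2 * a * K ^ (2 * N + 1)) * (pi * (1 + 2 / (exp (2 * pi * (a * K)) - 1)) - 1 / (a * K)) = g k"
    proof -
      have e: "exp (pi * (2 * a) * K) = exp (2 * pi * (a * K))" by (simp add: mult_ac)
      have "exp (2 * pi * (a * K)) - 1 \<noteq> 0" using assms K by simp
      thus ?thesis unfolding g_def K_def[symmetric] e
        using assms K by (simp add: power2_eq_square field_simps)
    qed
    ultimately have "(\<lambda>j. ?f (k, j)) sums g k" by simp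
    thus ?thesis by (rule sums_nonneg_imp_has_sum) simp
  qed
  have "g sums (pi / (2 * a) * ((\<Sum>k. 1 / real (Suc k) ^ (2 * N + 1)) + 2 * S_series (2 * N + 1) (2 * a))
      - 1 / (2 * a\<^sup>2) * even_zeta (N + 1))"
    unfolding g_def S_series_def
    using assms
    by (intro sums_diff sums_mult sums_add summable_sums summable_zeta summable_S_series
        has_sum_imp_sums even_zeta_has_sum) auto
  hence "g sums ?U" by (simp add: coth_series_def)
  moreover have "g k \<ge> 0" for k
    by (rule has_sum_nonneg[OF row]) simp
  ultimately have total: "(g has_sum ?U) UNIV" by (rule sums_nonneg_imp_has_sum)
  have "?f summable_on UNIV \<times> UNIV"
    by (rule summable_on_SigmaI[OF row]) (use total in \<open>auto simp: summable_on_def\<close>)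
  thus ?thesis by (intro has_sum_SigmaI[OF row total])
qed

section \<open>Ramanujan's formula relating \<open>a\<close> and \<open>1 / a\<close>\<close>

text \<open>Multiplied by \<open>A * p + q\<close>, the right-hand side telescopes to
  \<open>g 0 - g N\<close>. Oddness of \<open>N\<close> makes \<open>g N\<close> negative, so this
  difference is the sum on the left.\<close>

lemma alternating_partial_fractions:
  fixes A p q :: real
  assumes "A > 0" "p > 0" "q > 0" "odd N"
  shows "A * (1 / p ^ N + A ^ N / q ^ N) / (A * p + q) =
    (\<Sum>i<N. (-1) ^ i * A ^ (N - i) * (1 / (p ^ (i + 1) * q ^ (N - i))))"
proof -
  define g where "g i = (-1) ^ i * A ^ (N - i + 1) / (p ^ i * q ^ (N - i))" for i
  have "(A * p + q) * ((-1) ^ i * A ^ (N - i) * (1 / (p ^ (i + 1) * q ^ (N - i)))) = g i - g (Suc i)" if "i < N" for i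
  proof -
    define d where "d = N - Suc i"
    have "N - i = Suc d" "N - Suc i = d" using that by (simp_all add: d_def)
    thus ?thesis using assms by (simp add: g_def field_simps)
  qed
  hence "(A * p + q) * (\<Sum>i<N. (-1) ^ i * A ^ (N - i) * (1 / (p ^ (i + 1) * q ^ (N - i)))) = (\<Sum>i<N. g i - g (Suc i))"
    by (simp add: sum_distrib_left del: power_Suc)
  also have "\<dots> = g 0 - g N" by (rule sum_lessThan_telescope')
  also have "\<dots> = A * (1 / p ^ N + A ^ N / q ^ N)"
    using assms by (simp add: g_def algebra_simps)
  finally have "A * (1 / p ^ N + A ^ N / q ^ N) / (A * p + q) = (A * p + q) *
      (\<Sum>i<N. (-1) ^ i * A ^ (N - i) * (1 / (p ^ (i + 1) * q ^ (N - i)))) / (A * p + q)"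
    by (simp only:)
  moreover have "A * p + q > 0" using assms by (intro add_pos_pos mult_pos_pos)
  hence "A * p + q \<noteq> 0" by simp
  ultimately show ?thesis by (simp only: nonzero_mult_div_cancel_left not_False_eq_True)
qed

theorem ramanujan_formula_zeta:
  fixes a :: real
  assumes "a > 0" "odd N"
  shows "pi / 2 * (a * coth_series (2 * N + 1) a + a ^ (2 * N + 1) * coth_series (2 * N + 1) (1 / a)) =
    - (\<Sum>k=0..N+1. (-1) ^ k * a ^ (2 * N + 2 - 2 * k) * (even_zeta k * even_zeta (N + 1 - k)))"
proof -
  let ?C = "coth_series (2 * N + 1)" and ?U = "UNIV \<times> UNIV :: (nat \<times> nat) set"
  have N: "N > 0" using assms(2) by (rule odd_pos)
  let ?f = "\<lambda>a (k, j). 1 / (real (Suc k) ^ (2 * N) * (a\<^sup>2 * (real (Suc k))\<^sup>2 + (real (Suc j))\<^sup>2))"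
  let ?V = "\<lambda>a. pi / (2 * a) * ?C a - even_zeta (N + 1) / (2 * a\<^sup>2)"
  \<comment> \<open>The weight \<open>a\<^sup>2\<close> here and \<open>a ^ (2 * N)\<close> below
    produce the two terms on the left of \<open>alternating_partial_fractions\<close>, with
    \<open>A = a\<^sup>2\<close> and with \<open>p\<close>, \<open>q\<close> the squares of the two
    summation variables.\<close>
  have "((\<lambda>p. a\<^sup>2 * ?f a p) has_sum a\<^sup>2 * ?V a) ?U"
    by (intro has_sum_cmult_right coth_series_double_sum assms N)
  \<comment> \<open>With the variables exchanged, the denominator for \<open>1 / a\<close> is
    proportional to the one for \<open>a\<close>.\<close>
  moreover have "((\<lambda>(k, j). ?f (1 / a) (j, k)) has_sum ?V (1 / a)) ?U"
    by (subst has_sum_swap[symmetric]) (intro coth_series_double_sum N, use assms in simp)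
  hence "((\<lambda>p. a ^ (2 * N) * (\<lambda>(k, j). ?f (1 / a) (j, k)) p) has_sum a ^ (2 * N) * ?V (1 / a)) ?U"
    by (rule has_sum_cmult_right)
  ultimately have "((\<lambda>p. a\<^sup>2 * ?f a p + a ^ (2 * N) * (\<lambda>(k, j). ?f (1 / a) (j, k)) p) has_sum
      (a\<^sup>2 * ?V a + a ^ (2 * N) * ?V (1 / a))) ?U"
    by (rule has_sum_add)
  also have "(\<lambda>p. a\<^sup>2 * ?f a p + a ^ (2 * N) * (\<lambda>(k, j). ?f (1 / a) (j, k)) p) =
      (\<lambda>p. \<Sum>i<N. (-1) ^ i * a ^ (2 * (N - i)) *
        (\<lambda>(k, j). 1 / (real (Suc k) ^ (2 * (i + 1)) * real (Suc j) ^ (2 * (N - i)))) p)"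
  proof
    fix p :: "nat \<times> nat"
    obtain k j where p: "p = (k, j)" by fastforce
    define K J where "K = real (Suc k)" and "J = real (Suc j)"
    have KJ: "K > 0" "J > 0" by (simp_all add: K_def J_def)
    have pos: "a\<^sup>2 * K\<^sup>2 + J\<^sup>2 > 0" using assms KJ by (intro add_pos_pos) auto
    have "(1 / a)\<^sup>2 * J\<^sup>2 + K\<^sup>2 = (a\<^sup>2 * K\<^sup>2 + J\<^sup>2) / a\<^sup>2"
      using assms by (simp add: field_simps)
    hence "a\<^sup>2 * (1 / (K ^ (2 * N) * (a\<^sup>2 * K\<^sup>2 + J\<^sup>2))) +
        a ^ (2 * N) * (1 / (J ^ (2 * N) * ((1 / a)\<^sup>2 * J\<^sup>2 + K\<^sup>2))) =
        a\<^sup>2 * (1 / (K\<^sup>2) ^ N + (a\<^sup>2) ^ N / (J\<^sup>2) ^ N) / (a\<^sup>2 * K\<^sup>2 + J\<^sup>2)"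
      using pos KJ assms by (simp add: power_mult[symmetric] divide_simps) (simp add: algebra_simps)
    also have "\<dots> = (\<Sum>i<N. (-1) ^ i * (a\<^sup>2) ^ (N - i) * (1 / ((K\<^sup>2) ^ (i + 1) * (J\<^sup>2) ^ (N - i))))"
      by (rule alternating_partial_fractions) (use assms KJ in auto)
    finally show "a\<^sup>2 * ?f a p + a ^ (2 * N) * (\<lambda>(k, j). ?f (1 / a) (j, k)) p =
        (\<Sum>i<N. (-1) ^ i * a ^ (2 * (N - i)) *
        (\<lambda>(k, j). 1 / (real (Suc k) ^ (2 * (i + 1)) * real (Suc j) ^ (2 * (N - i)))) p)"
      by (simp only: p split K_def[symmetric] J_def[symmetric] power_mult)
  qed
  finally have "((\<lambda>p. \<Sum>i<N. (-1) ^ i * a ^ (2 * (N - i)) *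
        (\<lambda>(k, j). 1 / (real (Suc k) ^ (2 * (i + 1)) * real (Suc j) ^ (2 * (N - i)))) p) has_sum
      (a\<^sup>2 * ?V a + a ^ (2 * N) * ?V (1 / a))) ?U" .
  moreover have "((\<lambda>p. \<Sum>i<N. (-1) ^ i * a ^ (2 * (N - i)) *
        (\<lambda>(k, j). 1 / (real (Suc k) ^ (2 * (i + 1)) * real (Suc j) ^ (2 * (N - i)))) p) has_sum
      (\<Sum>i<N. (-1) ^ i * a ^ (2 * (N - i)) * (even_zeta (i + 1) * even_zeta (N - i)))) ?U"
    by (intro has_sum_sum has_sum_cmult_right even_zeta_product_has_sum) auto
  ultimately have eq: "a\<^sup>2 * ?V a + a ^ (2 * N) * ?V (1 / a) =
      (\<Sum>i<N. (-1) ^ i * a ^ (2 * (N - i)) * (even_zeta (i + 1) * even_zeta (N - i)))"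
    by (rule has_sum_unique)
  let ?t = "\<lambda>k. (-1) ^ k * a ^ (2 * N + 2 - 2 * k) * (even_zeta k * even_zeta (N + 1 - k))"
  \<comment> \<open>The inner terms are the double sums, with the sign flipped by the shift
    \<open>k = i + 1\<close>. The end terms, where \<open>even_zeta 0\<close> enters, cancel the two
    corrections left by \<open>coth_series_double_sum\<close>.\<close>
  have "(\<Sum>k=0..N+1. ?t k) = ?t 0 + (\<Sum>i<N. ?t (Suc i)) + ?t (N + 1)"
    by (simp add: sum.atLeast0_atMost_Suc sum.atMost_shift atLeast0AtMost del: sum.atMost_Suc power_Suc)
  also have "(\<Sum>i<N. ?t (Suc i)) =
      - (\<Sum>i<N. (-1) ^ i * a ^ (2 * (N - i)) * (even_zeta (i + 1) * even_zeta (N - i)))"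
    by (simp add: sum_negf[symmetric] diff_mult_distrib2)
  also have "?t 0 = - (a ^ (2 * N + 2) * even_zeta (N + 1) / 2)"
    by (simp add: even_zeta_0)
  also have "?t (N + 1) = - (even_zeta (N + 1) / 2)"
    using assms by (simp add: even_zeta_0)
  also have "(\<Sum>i<N. (-1) ^ i * a ^ (2 * (N - i)) * (even_zeta (i + 1) * even_zeta (N - i))) =
      pi / 2 * (a * ?C a + a ^ (2 * N + 1) * ?C (1 / a)) - even_zeta (N + 1) / 2 - a ^ (2 * N + 2) * even_zeta (N + 1) / 2"
    unfolding eq[symmetric] using assms by (simp add: field_simps power2_eq_square)
  finally show ?thesis by simp
qed

text \<open>Euler's closed form is inserted for every zeta value. Since \<open>N + 1\<close> is
  even, the two signs in each product cancel, and the power of \<open>2 * pi\<close> is the same for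
  all \<open>k\<close>.\<close>

corollary ramanujan_formula:
  fixes a :: real
  assumes "a > 0" "odd N"
  shows "a * coth_series (2 * N + 1) a + a ^ (2 * N + 1) * coth_series (2 * N + 1) (1 / a) =
    - (2 * 4 ^ N * pi ^ (2 * N + 1) * (\<Sum>k=0..N+1. (-1) ^ k * a ^ (2 * N + 2 - 2 * k) *
      (bernoulli (2 * k) * bernoulli (2 * N + 2 - 2 * k) / (fact (2 * k) * fact (2 * N + 2 - 2 * k)))))"
    (is "?L = - (_ * ?S)")
proof -
  let ?b = "\<lambda>k. bernoulli (2 * k) * bernoulli (2 * N + 2 - 2 * k) / (fact (2 * k) * fact (2 * N + 2 - 2 * k))"
  have "even_zeta k * even_zeta (N + 1 - k) = (2 * pi) ^ (2 * N + 2) / 4 * ?b k" if k: "k \<le> N + 1" for k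
  proof -
    obtain l where l: "N + 1 = k + l" using k le_Suc_ex by blast
    have "2 * N + 2 - 2 * k = 2 * l" "2 * N + 2 = 2 * k + 2 * l" "N + 1 - k = l" using l by auto
    moreover have "even (k + l)" using l assms(2) by presburger
    hence "(-1 :: real) ^ (k + 1) * (-1) ^ (l + 1) = 1" by (simp flip: power_add)
    ultimately show ?thesis
      by (simp only: even_zeta_def) (simp add: power_add field_simps)
  qed
  hence "(\<Sum>k=0..N+1. (-1) ^ k * a ^ (2 * N + 2 - 2 * k) * (even_zeta k * even_zeta (N + 1 - k))) =
      (2 * pi) ^ (2 * N + 2) / 4 * ?S"
    unfolding sum_distrib_left by (intro sum.cong) simp_all
  hence "pi / 2 * ?L = - ((2 * pi) ^ (2 * N + 2) / 4 * ?S)"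
    using ramanujan_formula_zeta[OF assms] by simp
  also have "(2 * pi) ^ (2 * N + 2) / 4 = pi / 2 * (2 * 4 ^ N * pi ^ (2 * N + 1))"
    by (simp add: power_mult_distrib power_add power_mult power2_eq_square)
  finally have "pi / 2 * ?L = pi / 2 * (- (2 * 4 ^ N * pi ^ (2 * N + 1) * ?S))"
    by (simp only: mult.assoc mult_minus_right)
  moreover have "pi / 2 \<noteq> 0" by simp
  ultimately show ?thesis using mult_left_cancel by blast
qed

section \<open>Positivity, and elimination of the odd zeta value\<close>

lemma S_series_pos:
  assumes "n \<ge> 1" "r > 0"
  shows "S_series n r > 0"
  unfolding S_series_def
  by (rule suminf_pos[OF summable_S_series[OF assms]]) (use assms in auto)

text \<open>Termwise, with \<open>e = exp (pi * real (Suc k))\<close>, the difference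
  \<open>1 / (e - 1) - 2 / (e * e - 1)\<close> equals \<open>1 / (e + 1)\<close>, which is
  positive.\<close>

lemma S_series_2_le_S_series_1:
  assumes "n \<ge> 1"
  shows "2 * S_series n 2 \<le> S_series n 1"
proof -
  let ?s = "\<lambda>r k. 1 / (real (Suc k) ^ n * (exp (pi * r * real (Suc k)) - 1))"
  have sm: "summable (?s 1)" "summable (?s 2)"
    by (rule summable_S_series; use assms in simp)+
  have le: "2 * ?s 2 k \<le> ?s 1 k" for k
  proof -
    define K e where "K = real (Suc k) ^ n" and "e = exp (pi * real (Suc k))"
    have "K > 0" by (simp add: K_def)
    have e: "e > 1" by (simp add: e_def)
    have "exp (pi * 2 * real (Suc k)) = e * e" by (simp add: e_def mult_ac flip: exp_add)
    hence "?s 2 k = 1 / (K * (e * e - 1))" by (simp only: K_def)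
    moreover have "1 / (K * (e - 1)) - 2 * (1 / (K * (e * e - 1))) = 1 / (K * (e + 1))"
    proof -
      have "e * e - 1 = (e - 1) * (e + 1)" by (simp add: algebra_simps)
      thus ?thesis using \<open>K > 0\<close> e by (simp add: divide_simps)
    qed
    moreover have "1 / (K * (e + 1)) > 0" using \<open>K > 0\<close> e by simp
    moreover have "?s 1 k = 1 / (K * (e - 1))" by (simp add: K_def e_def)
    ultimately show ?thesis by linarith
  qed
  have "(\<Sum>k. 2 * ?s 2 k) \<le> suminf (?s 1)"
    by (intro suminf_le summable_mult sm le)
  thus ?thesis
    unfolding S_series_def suminf_mult[OF sm(2)] .
qed

theorem mainTheorem1:
  fixes m :: nat
  assumes "m \<ge> 1"
  shows "pi ^ (4*m - 1) =
    4 ^ (2*m - 1) / D_coeff m * S_series (4*m - 1) 1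
    - (4 ^ (2*m - 1) + 1) / D_coeff m * S_series (4*m - 1) 2
    + 1 / D_coeff m * S_series (4*m - 1) 4"
proof -
  define N where "N = 2 * m - 1"
  have N: "odd N" "4 * m - 1 = 2 * N + 1" using assms by (auto simp: N_def)
  let ?C = "coth_series (2 * N + 1)" and ?S = "S_series (2 * N + 1)"
  define P where "P = pi ^ (2 * N + 1)"
  \<comment> \<open>At \<open>a = 1\<close> the two series on the left coincide, which removes the
    factor 2.\<close>
  have C1: "?C 1 = - (4 ^ N * P * F_coeff N)"
    using ramanujan_formula[of 1 N] N by (simp add: F_coeff_def P_def)
  have C2: "4 ^ N * ?C (1 / 2) + ?C 2 = - (4 ^ N * P * G_coeff N)"
  proof -
    \<comment> \<open>The powers of \<open>a = 1 / 2\<close> supply \<open>4 ^ k\<close>, turning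
      the sign \<open>(-1) ^ k\<close> into the weight \<open>(-4) ^ k\<close> of
      \<open>G_coeff\<close>.\<close>
    have half: "(1 / 2) ^ (2 * N + 2 - 2 * k) = (4 ^ k / 4 ^ (N + 1) :: real)" if "k \<le> N + 1" for k
    proof -
      have "2 * N + 2 - 2 * k = 2 * (N + 1 - k)" by simp
      thus ?thesis using that by (simp add: power_mult power_diff power_divide power2_eq_square del: power_Suc)
    qed
    have "(\<Sum>k=0..N+1. (-1) ^ k * (1 / 2) ^ (2 * N + 2 - 2 * k) *
      (bernoulli (2 * k) * bernoulli (2 * N + 2 - 2 * k) / (fact (2 * k) * fact (2 * N + 2 - 2 * k)))) =
      G_coeff N / 4 ^ (N + 1)"
      unfolding G_coeff_def sum_divide_distrib
    proof (intro sum.cong refl, goal_cases)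
      case (1 k)
      have "(-4) ^ k = (-1) ^ k * (4::real) ^ k" by (simp flip: power_mult_distrib)
      thus ?case using half[of k] 1 by (simp only:) simp
    qed
    with ramanujan_formula[of "1 / 2" N] N
    have "1 / 2 * ?C (1 / 2) + (1 / 2) ^ (2 * N + 1) * ?C 2 = - (2 * 4 ^ N * P * (G_coeff N / 4 ^ (N + 1)))"
      by (simp add: P_def)
    moreover have "(1 / 2) ^ (2 * N + 1) = (1 / (2 * 4 ^ N) :: real)"
      by (simp add: power_mult power_divide power2_eq_square)
    ultimately show ?thesis by (simp add: field_simps)
  qed
  \<comment> \<open>The weights of \<open>?C (1 / 2)\<close>, \<open>?C 2\<close> and
    \<open>?C 1\<close> add up to 0, so the common zeta series drops out.\<close>
  have "4 ^ N * ?S 1 - (4 ^ N + 1) * ?S 2 + ?S 4 = (4 ^ N * ?C (1 / 2) + ?C 2 - (4 ^ N + 1) * ?C 1) / 2"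
    by (simp add: coth_series_def field_simps)
  also have "\<dots> = P * D_coeff m"
    unfolding C1 C2 D_coeff_def N_def[symmetric] by (simp add: field_simps)
  finally have main: "4 ^ N * ?S 1 - (4 ^ N + 1) * ?S 2 + ?S 4 = P * D_coeff m" .
  \<comment> \<open>The chain
    \<open>4 ^ N * ?S 1 \<ge> 2 * 4 ^ N * ?S 2 \<ge> (4 ^ N + 1) * ?S 2\<close> bounds the first two
    terms, and \<open>?S 4\<close> makes the inequality strict.\<close>
  have "?S 4 > 0" by (rule S_series_pos) simp_all
  moreover have "4 ^ N * (2 * ?S 2) \<le> 4 ^ N * ?S 1"
    using S_series_2_le_S_series_1[of "2 * N + 1"] by (intro mult_left_mono) auto
  moreover have "1 * ?S 2 \<le> 4 ^ N * ?S 2"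
    using S_series_pos[of "2 * N + 1" 2] by (intro mult_right_mono) auto
  ultimately have "4 ^ N * ?S 1 - (4 ^ N + 1) * ?S 2 + ?S 4 > 0"
    unfolding distrib_right by linarith
  hence "D_coeff m \<noteq> 0" unfolding main by auto
  thus ?thesis unfolding N N_def[symmetric] P_def[symmetric]
    using main by (simp add: field_simps)
qed

end
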